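(* Let $(\mathfrak{g},[-,-]_1,[-,-]_2)$ be a compatible Lie algebra, let $(\rho,\mu,V)$ be a representation of it, and let $T:V\to\mathfrak{g}$ be an anti-$\mathcal{O}$-operator associated to $(\rho,\mu,V)$. Define bilinear operations on $V$ by $$u\circ v=-\rho(T(u))v,\qquad u\ast v=-\mu(T(u))v,\qquad \forall u,v\in V,$$ and put $[u,v]_1=u\circ v-v\circ u$, $[u,v]_2=u\ast v-v\ast u$ on $V$. Then for all $u,v,w\in V$ $$u\circ(v\ast w)+u\ast(v\circ w)-v\circ(u\ast w)-v\ast(u\circ w)=[v,u]_2\circ w+[v,u]_1\ast w.$$ Moreover, $(V,\circ,\ast)$ is a compatible Lie-admissible algebra such that $(V,\circ,\ast)$ is a compatible anti-pre-Lie algebra if and only if $T$ is strong. Furthermore, $T$ is a homomorphism of compatible Lie algebras from the sub-adjacent Lie algebra $\mathfrak{g}(V)=(V,[-,-]_1,[-,-]_2)$ to $(\mathfrak{g},[-,-]_1,[-,-]_2)$. Moreover, there is an induced compatible anti-pre-Lie algebra structure on $T(V)=\{T(u)\mid u\in V\}$ given by $$T(u)\circ T(v)=T(u\circ v),\qquad T(u)\ast T(v)=T(u\ast v),\qquad \forall u,v\in V,$$ and $T$ is a homomorphism of compatible anti-pre-Lie algebras.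
   Context: All vector spaces and algebras are finite-dimensional over $\mathbb{C}$. An anti-pre-Lie algebra is a vector space $A$ with a bilinear operation $\cdot$ such that, with $[x,y]=x\cdot y-y\cdot x$, for all $x,y,z\in A$: $x\cdot(y\cdot z)-y\cdot(x\cdot z)=[y,x]\cdot z$ and $[x,y]\cdot z+[y,z]\cdot x+[z,x]\cdot y=0$. $(A,\circ,\ast)$ is a compatible anti-pre-Lie algebra if $(A,\circ)$ and $(A,\ast)$ are anti-pre-Lie algebras and for all $k_1,k_2\in\mathbb{C}$ the operation $k_1x\circ y+k_2x\ast y$ makes $A$ an anti-pre-Lie algebra. A compatible Lie algebra $(\mathfrak{g},[-,-]_1,[-,-]_2)$ is a vector space with two Lie brackets such that $k_1[-,-]_1+k_2[-,-]_2$ is a Lie bracket for all $k_1,k_2\in\mathbb{C}$. A representation $(\rho,\mu,V)$ of it is a vector space $V$ with linear maps $\rho,\mu:\mathfrak{g}\to\mathfrak{gl}(V)$ such that for all $k_1,k_2\in\mathbb{C}$, $k_1\rho+k_2\mu$ is a representation of the Lie algebra $(\mathfrak{g},k_1[-,-]_1+k_2[-,-]_2)$. $(A,\circ,\ast)$ is a compatible Lie-admissible algebra if the commutators $x\circ y-y\circ x$ and $x\ast y-y\ast x$ form a compatible Lie algebra on $A$. The sub-adjacent structure $\mathfrak{g}(A)$ is $A$ equipped with these two commutators. Homomorphisms of compatible Lie algebras (resp. compatible anti-pre-Lie algebras) are linear maps preserving both operations. For a Lie algebra $(\mathfrak{g},[-,-])$ with representation $(\rho,V)$, a linear map $T:V\to\mathfrak{g}$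 is an anti-$\mathcal{O}$-operator associated to $(\rho,V)$ if $[T(u),T(v)]=T(\rho(T(v))u-\rho(T(u))v)$ for all $u,v\in V$; it is strong if moreover $\rho([T(u),T(v)])w+\rho([T(v),T(w)])u+\rho([T(w),T(u)])v=0$ for all $u,v,w\in V$. For a compatible Lie algebra $(\mathfrak{g},[-,-]_1,[-,-]_2)$ with representation $(\rho,\mu,V)$, a linear map $T:V\to\mathfrak{g}$ is an anti-$\mathcal{O}$-operator associated to $(\rho,\mu,V)$ if for all $k_1,k_2\in\mathbb{C}$ it is an anti-$\mathcal{O}$-operator of $(\mathfrak{g},k_1[-,-]_1+k_2[-,-]_2)$ associated to $k_1\rho+k_2\mu$; it is strong if for all $k_1,k_2\in\mathbb{C}$ it is strong as such an operator. The phrase "$(V,\circ,\ast)$ is a compatible Lie-admissible algebra such that $(V,\circ,\ast)$ is a compatible anti-pre-Lie algebra" means that both properties hold. *)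

theory Defs
  imports Complex_Main
begin

text \<open>
  Complex vector spaces are given by a scalar multiplication \<open>s\<close> on an additive
  group together with a carrier \<open>A\<close>, a finite-dimensional linear subspace; this lets
  the image \<open>T(V)\<close> of a linear map be treated as a vector space in its own right.
  Maps and operations are only constrained on the carriers.
\<close>

definition fd_space :: "(complex \<Rightarrow> 'a::ab_group_add \<Rightarrow> 'a) \<Rightarrow> 'a set \<Rightarrow> bool" where
  "fd_space s A \<longleftrightarrow> vector_space s \<and> module.subspace s A \<and>
     (\<exists>B. finite B \<and> module.span s B = A)"

definition linear_on ::
  "(complex \<Rightarrow> 'a::ab_group_add \<Rightarrow> 'a) \<Rightarrow> 'a set \<Rightarrow>
   (complex \<Rightarrow> 'b::ab_group_add \<Rightarrow> 'b) \<Rightarrow> 'b set \<Rightarrow> ('a \<Rightarrow> 'b) \<Rightarrow> bool" where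
  "linear_on s A t B f \<longleftrightarrow>
     (\<forall>x\<in>A. f x \<in> B) \<and>
     (\<forall>x\<in>A. \<forall>y\<in>A. f (x + y) = f x + f y) \<and>
     (\<forall>c. \<forall>x\<in>A. f (s c x) = t c (f x))"

text \<open>
  Bilinear maps \<open>A \<times> B \<rightarrow> B\<close>. For \<open>A = B\<close> these are the algebra operations on \<open>A\<close>;
  in curried form they are also exactly the linear maps from \<open>A\<close> to \<open>gl(B)\<close>.
\<close>

definition bilinear_on ::
  "(complex \<Rightarrow> 'a::ab_group_add \<Rightarrow> 'a) \<Rightarrow> 'a set \<Rightarrow>
   (complex \<Rightarrow> 'b::ab_group_add \<Rightarrow> 'b) \<Rightarrow> 'b set \<Rightarrow> ('a \<Rightarrow> 'b \<Rightarrow> 'b) \<Rightarrow> bool" where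
  "bilinear_on s A t B m \<longleftrightarrow>
     (\<forall>x\<in>A. linear_on t B t B (m x)) \<and>
     (\<forall>y\<in>B. linear_on s A t B (\<lambda>x. m x y))"

definition lincomb ::
  "(complex \<Rightarrow> 'b::ab_group_add \<Rightarrow> 'b) \<Rightarrow>
   complex \<Rightarrow> ('a \<Rightarrow> 'b \<Rightarrow> 'b) \<Rightarrow> complex \<Rightarrow> ('a \<Rightarrow> 'b \<Rightarrow> 'b) \<Rightarrow> 'a \<Rightarrow> 'b \<Rightarrow> 'b" where
  "lincomb s k1 m1 k2 m2 = (\<lambda>x y. s k1 (m1 x y) + s k2 (m2 x y))"

definition commutator :: "('a \<Rightarrow> 'a \<Rightarrow> 'a::ab_group_add) \<Rightarrow> 'a \<Rightarrow> 'a \<Rightarrow> 'a" where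
  "commutator m = (\<lambda>x y. m x y - m y x)"

definition lie_algebra ::
  "(complex \<Rightarrow> 'a::ab_group_add \<Rightarrow> 'a) \<Rightarrow> 'a set \<Rightarrow> ('a \<Rightarrow> 'a \<Rightarrow> 'a) \<Rightarrow> bool" where
  "lie_algebra s A b \<longleftrightarrow>
     fd_space s A \<and> bilinear_on s A s A b \<and>
     (\<forall>x\<in>A. b x x = 0) \<and>
     (\<forall>x\<in>A. \<forall>y\<in>A. \<forall>z\<in>A. b (b x y) z + b (b y z) x + b (b z x) y = 0)"

definition lie_representation ::
  "(complex \<Rightarrow> 'g::ab_group_add \<Rightarrow> 'g) \<Rightarrow> 'g set \<Rightarrow> ('g \<Rightarrow> 'g \<Rightarrow> 'g) \<Rightarrow>
   (complex \<Rightarrow> 'v::ab_group_add \<Rightarrow> 'v) \<Rightarrow> 'v set \<Rightarrow> ('g \<Rightarrow> 'v \<Rightarrow> 'v) \<Rightarrow> bool" where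
  "lie_representation s G b t V \<rho> \<longleftrightarrow>
     fd_space t V \<and> bilinear_on s G t V \<rho> \<and>
     (\<forall>x\<in>G. \<forall>y\<in>G. \<forall>v\<in>V. \<rho> (b x y) v = \<rho> x (\<rho> y v) - \<rho> y (\<rho> x v))"

definition anti_pre_lie_algebra ::
  "(complex \<Rightarrow> 'a::ab_group_add \<Rightarrow> 'a) \<Rightarrow> 'a set \<Rightarrow> ('a \<Rightarrow> 'a \<Rightarrow> 'a) \<Rightarrow> bool" where
  "anti_pre_lie_algebra s A m \<longleftrightarrow>
     fd_space s A \<and> bilinear_on s A s A m \<and>
     (\<forall>x\<in>A. \<forall>y\<in>A. \<forall>z\<in>A. m x (m y z) - m y (m x z) = m (commutator m y x) z) \<and>
     (\<forall>x\<in>A. \<forall>y\<in>A. \<forall>z\<in>A.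
        m (commutator m x y) z + m (commutator m y z) x + m (commutator m z x) y = 0)"

definition compatible_lie_algebra ::
  "(complex \<Rightarrow> 'a::ab_group_add \<Rightarrow> 'a) \<Rightarrow> 'a set \<Rightarrow>
   ('a \<Rightarrow> 'a \<Rightarrow> 'a) \<Rightarrow> ('a \<Rightarrow> 'a \<Rightarrow> 'a) \<Rightarrow> bool" where
  "compatible_lie_algebra s A b1 b2 \<longleftrightarrow>
     lie_algebra s A b1 \<and> lie_algebra s A b2 \<and>
     (\<forall>k1 k2. lie_algebra s A (lincomb s k1 b1 k2 b2))"

definition compatible_representation ::
  "(complex \<Rightarrow> 'g::ab_group_add \<Rightarrow> 'g) \<Rightarrow> 'g set \<Rightarrow>
   ('g \<Rightarrow> 'g \<Rightarrow> 'g) \<Rightarrow> ('g \<Rightarrow> 'g \<Rightarrow> 'g) \<Rightarrow>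
   (complex \<Rightarrow> 'v::ab_group_add \<Rightarrow> 'v) \<Rightarrow> 'v set \<Rightarrow>
   ('g \<Rightarrow> 'v \<Rightarrow> 'v) \<Rightarrow> ('g \<Rightarrow> 'v \<Rightarrow> 'v) \<Rightarrow> bool" where
  "compatible_representation s G b1 b2 t V \<rho> \<mu> \<longleftrightarrow>
     fd_space t V \<and> bilinear_on s G t V \<rho> \<and> bilinear_on s G t V \<mu> \<and>
     (\<forall>k1 k2. lie_representation s G (lincomb s k1 b1 k2 b2) t V (lincomb t k1 \<rho> k2 \<mu>))"

definition compatible_anti_pre_lie_algebra ::
  "(complex \<Rightarrow> 'a::ab_group_add \<Rightarrow> 'a) \<Rightarrow> 'a set \<Rightarrow>
   ('a \<Rightarrow> 'a \<Rightarrow> 'a) \<Rightarrow> ('a \<Rightarrow> 'a \<Rightarrow> 'a) \<Rightarrow> bool" where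
  "compatible_anti_pre_lie_algebra s A m1 m2 \<longleftrightarrow>
     anti_pre_lie_algebra s A m1 \<and> anti_pre_lie_algebra s A m2 \<and>
     (\<forall>k1 k2. anti_pre_lie_algebra s A (lincomb s k1 m1 k2 m2))"

definition compatible_lie_admissible_algebra ::
  "(complex \<Rightarrow> 'a::ab_group_add \<Rightarrow> 'a) \<Rightarrow> 'a set \<Rightarrow>
   ('a \<Rightarrow> 'a \<Rightarrow> 'a) \<Rightarrow> ('a \<Rightarrow> 'a \<Rightarrow> 'a) \<Rightarrow> bool" where
  "compatible_lie_admissible_algebra s A m1 m2 \<longleftrightarrow>
     fd_space s A \<and> bilinear_on s A s A m1 \<and> bilinear_on s A s A m2 \<and>
     compatible_lie_algebra s A (commutator m1) (commutator m2)"

text \<open>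
  Homomorphisms of compatible Lie algebras and of compatible anti-pre-Lie algebras alike:
  linear maps preserving both operations. The axioms of the structures on either side
  are not part of this predicate.
\<close>

definition compatible_hom ::
  "(complex \<Rightarrow> 'a::ab_group_add \<Rightarrow> 'a) \<Rightarrow> 'a set \<Rightarrow>
   ('a \<Rightarrow> 'a \<Rightarrow> 'a) \<Rightarrow> ('a \<Rightarrow> 'a \<Rightarrow> 'a) \<Rightarrow>
   (complex \<Rightarrow> 'b::ab_group_add \<Rightarrow> 'b) \<Rightarrow> 'b set \<Rightarrow>
   ('b \<Rightarrow> 'b \<Rightarrow> 'b) \<Rightarrow> ('b \<Rightarrow> 'b \<Rightarrow> 'b) \<Rightarrow> ('a \<Rightarrow> 'b) \<Rightarrow> bool" where
  "compatible_hom s A m1 m2 t B n1 n2 f \<longleftrightarrow>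
     linear_on s A t B f \<and>
     (\<forall>x\<in>A. \<forall>y\<in>A. f (m1 x y) = n1 (f x) (f y)) \<and>
     (\<forall>x\<in>A. \<forall>y\<in>A. f (m2 x y) = n2 (f x) (f y))"

definition anti_O_operator ::
  "(complex \<Rightarrow> 'g::ab_group_add \<Rightarrow> 'g) \<Rightarrow> 'g set \<Rightarrow> ('g \<Rightarrow> 'g \<Rightarrow> 'g) \<Rightarrow>
   (complex \<Rightarrow> 'v::ab_group_add \<Rightarrow> 'v) \<Rightarrow> 'v set \<Rightarrow> ('g \<Rightarrow> 'v \<Rightarrow> 'v) \<Rightarrow>
   ('v \<Rightarrow> 'g) \<Rightarrow> bool" where
  "anti_O_operator s G b t V \<rho> T \<longleftrightarrow>
     linear_on t V s G T \<and>
     (\<forall>u\<in>V. \<forall>v\<in>V. b (T u) (T v) = T (\<rho> (T v) u - \<rho> (T u) v))"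

definition strong_anti_O_operator ::
  "(complex \<Rightarrow> 'g::ab_group_add \<Rightarrow> 'g) \<Rightarrow> 'g set \<Rightarrow> ('g \<Rightarrow> 'g \<Rightarrow> 'g) \<Rightarrow>
   (complex \<Rightarrow> 'v::ab_group_add \<Rightarrow> 'v) \<Rightarrow> 'v set \<Rightarrow> ('g \<Rightarrow> 'v \<Rightarrow> 'v) \<Rightarrow>
   ('v \<Rightarrow> 'g) \<Rightarrow> bool" where
  "strong_anti_O_operator s G b t V \<rho> T \<longleftrightarrow>
     anti_O_operator s G b t V \<rho> T \<and>
     (\<forall>u\<in>V. \<forall>v\<in>V. \<forall>w\<in>V.
        \<rho> (b (T u) (T v)) w + \<rho> (b (T v) (T w)) u + \<rho> (b (T w) (T u)) v = 0)"

definition compatible_anti_O_operator ::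
  "(complex \<Rightarrow> 'g::ab_group_add \<Rightarrow> 'g) \<Rightarrow> 'g set \<Rightarrow>
   ('g \<Rightarrow> 'g \<Rightarrow> 'g) \<Rightarrow> ('g \<Rightarrow> 'g \<Rightarrow> 'g) \<Rightarrow>
   (complex \<Rightarrow> 'v::ab_group_add \<Rightarrow> 'v) \<Rightarrow> 'v set \<Rightarrow>
   ('g \<Rightarrow> 'v \<Rightarrow> 'v) \<Rightarrow> ('g \<Rightarrow> 'v \<Rightarrow> 'v) \<Rightarrow> ('v \<Rightarrow> 'g) \<Rightarrow> bool" where
  "compatible_anti_O_operator s G b1 b2 t V \<rho> \<mu> T \<longleftrightarrow>
     (\<forall>k1 k2. anti_O_operator s G (lincomb s k1 b1 k2 b2) t V (lincomb t k1 \<rho> k2 \<mu>) T)"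

definition strong_compatible_anti_O_operator ::
  "(complex \<Rightarrow> 'g::ab_group_add \<Rightarrow> 'g) \<Rightarrow> 'g set \<Rightarrow>
   ('g \<Rightarrow> 'g \<Rightarrow> 'g) \<Rightarrow> ('g \<Rightarrow> 'g \<Rightarrow> 'g) \<Rightarrow>
   (complex \<Rightarrow> 'v::ab_group_add \<Rightarrow> 'v) \<Rightarrow> 'v set \<Rightarrow>
   ('g \<Rightarrow> 'v \<Rightarrow> 'v) \<Rightarrow> ('g \<Rightarrow> 'v \<Rightarrow> 'v) \<Rightarrow> ('v \<Rightarrow> 'g) \<Rightarrow> bool" where
  "strong_compatible_anti_O_operator s G b1 b2 t V \<rho> \<mu> T \<longleftrightarrow>
     (\<forall>k1 k2. strong_anti_O_operator s G (lincomb s k1 b1 k2 b2) t V (lincomb t k1 \<rho> k2 \<mu>) T)"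

end

theory Submission
  imports Defs
begin

text \<open>
  The notions in the theorem are pencils: each property is required of all combinations
  \<open>k1 \<cdot> _ + k2 \<cdot> _\<close>, and \<open>T\<close>, the commutator and the operations \<open>-\<rho>(T u) v\<close>,
  \<open>-\<mu>(T u) v\<close> are compatible with forming these combinations. So the proof is about a single
  Lie bracket \<open>b\<close>, a representation \<open>\<rho>\<close> and the operation \<open>u \<cdot> v = -\<rho>(T u) v\<close>. There the
  anti-\<open>\<O>\<close>-operator equation says that \<open>T [u,v] = b (T u) (T v)\<close>, and this
  turns the representation property into the first anti-pre-Lie identity
  \<open>u \<cdot> (v \<cdot> w) - v \<cdot> (u \<cdot> w) = [v,u] \<cdot> w\<close>, for every \<open>T\<close>. It also turns the second
  identity, the vanishing of the cyclic sum of \<open>[u,v] \<cdot> w\<close>, into the strongness condition.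
  The mixed identity is the polarisation of the first one along the pencil.

  The first identity alone implies that the Jacobiator of the commutator is twice the
  cyclic sum of \<open>[u,v] \<cdot> w\<close> (\<open>jacobiator_eq_twice_cyclic_sum\<close>). This is used in both
  directions. An anti-pre-Lie algebra is Lie-admissible, as the equivalence with
  strongness demands. On \<open>T(V)\<close>, conversely, the commutator of the induced operation is the given bracket
  \<open>b\<close>, so the Jacobiator vanishes and hence so does the cyclic sum: the image is
  anti-pre-Lie whether or not \<open>T\<close> is strong. The induced operation is well
  defined because \<open>T(u \<cdot> v) = -T(\<rho>(T u) v)\<close> visibly depends on \<open>T u\<close> only, and
  \<open>T(u \<cdot> v) = b (T u) (T v) + T(v \<cdot> u)\<close> shows the same for \<open>T v\<close>.
\<close>

section \<open>Linear maps and subspaces on carriers\<close>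

lemma fd_space_module: "fd_space s A \<Longrightarrow> module s"
  by (simp add: fd_space_def module_iff_vector_space)

lemma fd_space_closed:
  assumes "fd_space s A"
  shows "0 \<in> A" and "x \<in> A \<Longrightarrow> y \<in> A \<Longrightarrow> x + y \<in> A"
    and "x \<in> A \<Longrightarrow> s c x \<in> A" and "x \<in> A \<Longrightarrow> - x \<in> A"
    and "x \<in> A \<Longrightarrow> y \<in> A \<Longrightarrow> x - y \<in> A"
proof -
  interpret module s by (rule fd_space_module[OF assms])
  have A: "subspace A" using assms by (simp add: fd_space_def)
  show "0 \<in> A" by (rule subspace_0[OF A])
  show "x \<in> A \<Longrightarrow> y \<in> A \<Longrightarrow> x + y \<in> A" by (rule subspace_add[OF A])
  show "x \<in> A \<Longrightarrow> s c x \<in> A" by (rule subspace_scale[OF A])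
  show "x \<in> A \<Longrightarrow> - x \<in> A" by (rule subspace_neg[OF A])
  show "x \<in> A \<Longrightarrow> y \<in> A \<Longrightarrow> x - y \<in> A" by (rule subspace_diff[OF A])
qed

lemma fd_space_double_eq_0:
  fixes s :: "complex \<Rightarrow> 'a::ab_group_add \<Rightarrow> 'a" and x :: 'a
  assumes "fd_space s A" and "x + x = 0"
  shows "x = 0"
proof -
  interpret vector_space s using assms(1) by (simp add: fd_space_def)
  have "s 2 x = 0"
    using assms(2) scale_left_distrib[of 1 1 x] by simp
  then show ?thesis by simp
qed

lemma lincomb_1_0 [simp]: "module s \<Longrightarrow> lincomb s 1 m 0 n = m"
  and lincomb_0_1 [simp]: "module s \<Longrightarrow> lincomb s 0 m 1 n = n"
  and lincomb_1_1: "module s \<Longrightarrow> lincomb s 1 m 1 n = (\<lambda>x y. m x y + n x y)"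
  by (simp_all add: lincomb_def module.scale_one module.scale_zero_left)

lemma commutator_lincomb:
  assumes "module s"
  shows "commutator (lincomb s k1 m k2 n) = lincomb s k1 (commutator m) k2 (commutator n)"
  by (simp add: fun_eq_iff commutator_def lincomb_def module.scale_right_diff_distrib[OF assms]
      algebra_simps)

lemma linear_onI_add_scale:
  assumes "\<And>x. x \<in> A \<Longrightarrow> f x \<in> B"
    and "\<And>x y. x \<in> A \<Longrightarrow> y \<in> A \<Longrightarrow> f (x + y) = f x + f y"
    and "\<And>c x. x \<in> A \<Longrightarrow> f (s c x) = t c (f x)"
  shows "linear_on s A t B f"
  using assms by (simp add: linear_on_def)

lemma linear_onD:
  assumes "linear_on s A t B f"
  shows "x \<in> A \<Longrightarrow> f x \<in> B"
    and "x \<in> A \<Longrightarrow> y \<in> A \<Longrightarrow> f (x + y) = f x + f y"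
    and "x \<in> A \<Longrightarrow> f (s c x) = t c (f x)"
  using assms by (simp_all add: linear_on_def)

lemma linear_on_diff:
  assumes "linear_on s A t B f" and "fd_space s A" and "x \<in> A" and "y \<in> A"
  shows "f (x - y) = f x - f y"
  using linear_onD(2)[OF assms(1), of "x - y" y] fd_space_closed(5)[OF assms(2)] assms(3,4)
  by simp

lemma linear_on_0:
  assumes "linear_on s A t B f" and "fd_space s A"
  shows "f 0 = 0"
  using linear_on_diff[OF assms, of 0 0] fd_space_closed(1)[OF assms(2)] by simp

lemma linear_on_minus:
  assumes "linear_on s A t B f" and "fd_space s A" and "x \<in> A"
  shows "f (- x) = - f x"
  using linear_on_diff[OF assms(1,2), of 0 x] linear_on_0[OF assms(1,2)]
    fd_space_closed(1)[OF assms(2)] assms(3) by simp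

lemma linear_on_uminus:
  assumes "linear_on s A t B f" and "fd_space t B"
  shows "linear_on s A t B (\<lambda>x. - f x)"
proof -
  interpret module t by (rule fd_space_module[OF assms(2)])
  show ?thesis
    by (rule linear_onI_add_scale)
      (simp_all add: linear_onD[OF assms(1)] fd_space_closed[OF assms(2)])
qed

lemma linear_on_compose:
  assumes "linear_on s A t B f" and "linear_on t B r C g"
  shows "linear_on s A r C (\<lambda>x. g (f x))"
  using assms by (simp add: linear_on_def)

lemma linear_on_cong:
  assumes "fd_space s A" and "\<And>x. x \<in> A \<Longrightarrow> f x = g x"
  shows "linear_on s A t B f \<longleftrightarrow> linear_on s A t B g"
  using assms(2) fd_space_closed[OF assms(1)] by (simp add: linear_on_def)

lemma linear_on_diff_fun:
  assumes "linear_on s A t B f" and "linear_on s A t B g" and "fd_space t B"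
  shows "linear_on s A t B (\<lambda>x. f x - g x)"
proof -
  interpret module t by (rule fd_space_module[OF assms(3)])
  show ?thesis
    by (rule linear_onI_add_scale)
      (simp_all add: linear_onD[OF assms(1)] linear_onD[OF assms(2)]
        fd_space_closed[OF assms(3)] scale_right_diff_distrib)
qed

lemma bilinear_on_commutator:
  assumes "bilinear_on s A s A m" and "fd_space s A"
  shows "bilinear_on s A s A (commutator m)"
  using assms by (simp add: bilinear_on_def commutator_def linear_on_diff_fun)

lemma bilinear_on_diff:
  assumes "bilinear_on s A t B m" and "fd_space s A" and "fd_space t B"
  shows "x \<in> A \<Longrightarrow> y \<in> A \<Longrightarrow> v \<in> B \<Longrightarrow> m (x - y) v = m x v - m y v"
    and "x \<in> A \<Longrightarrow> v \<in> B \<Longrightarrow> w \<in> B \<Longrightarrow> m x (v - w) = m x v - m x w"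
proof -
  show "m (x - y) v = m x v - m y v" if "x \<in> A" "y \<in> A" "v \<in> B"
    using linear_on_diff[OF _ assms(2), of t B "\<lambda>x. m x v"] assms(1) that
    by (simp add: bilinear_on_def)
  show "m x (v - w) = m x v - m x w" if "x \<in> A" "v \<in> B" "w \<in> B"
    using linear_on_diff[OF _ assms(3), of t B "m x"] assms(1) that
    by (simp add: bilinear_on_def)
qed

lemma bilinear_on_closed:
  "bilinear_on s A t B m \<Longrightarrow> x \<in> A \<Longrightarrow> y \<in> B \<Longrightarrow> m x y \<in> B"
  by (simp add: bilinear_on_def linear_on_def)

lemma bilinear_on_add:
  assumes "bilinear_on s A t B m"
  shows "x \<in> A \<Longrightarrow> y \<in> A \<Longrightarrow> v \<in> B \<Longrightarrow> m (x + y) v = m x v + m y v"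
    and "x \<in> A \<Longrightarrow> v \<in> B \<Longrightarrow> w \<in> B \<Longrightarrow> m x (v + w) = m x v + m x w"
  using assms by (simp_all add: bilinear_on_def linear_on_def)

lemma fd_space_image:
  assumes T: "linear_on t V s G T" and V: "fd_space t V" and G: "fd_space s G"
  shows "fd_space s (T ` V)"
proof -
  interpret t: module t by (rule fd_space_module[OF V])
  interpret s: module s by (rule fd_space_module[OF G])
  note V_closed = fd_space_closed[OF V]
  obtain B where B: "finite B" "t.span B = V" using V by (auto simp: fd_space_def)
  have BV: "B \<subseteq> V" using B(2) t.span_superset by blast
  have sub: "s.subspace (T ` V)"
  proof (rule s.subspaceI)
    show "0 \<in> T ` V" using linear_on_0[OF T V] V_closed(1) by force
    show "x + y \<in> T ` V" if "x \<in> T ` V" "y \<in> T ` V" for x y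
      using that by (auto simp: linear_onD(2)[OF T, symmetric] V_closed(2))
    show "s c x \<in> T ` V" if "x \<in> T ` V" for c x
      using that by (auto simp: linear_onD(3)[OF T, symmetric] V_closed(3))
  qed
  \<comment> \<open>\<open>T\<close> is linear on \<open>V\<close> only, so membership in \<open>V\<close> is carried along the span of \<open>B\<close>.\<close>
  have "t.subspace {v \<in> V. T v \<in> s.span (T ` B)}"
    by (rule t.subspaceI)
      (auto simp: V_closed linear_on_0[OF T V] linear_onD(2,3)[OF T]
        s.span_zero s.span_add s.span_scale)
  then have "t.span B \<subseteq> {v \<in> V. T v \<in> s.span (T ` B)}"
    using BV by (intro t.span_minimal) (auto intro: s.span_base)
  then have "T ` V \<subseteq> s.span (T ` B)" using B(2) by blast
  moreover have "s.span (T ` B) \<subseteq> T ` V"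
    using BV sub by (intro s.span_minimal) auto
  ultimately have "s.span (T ` B) = T ` V" by blast
  then show ?thesis using G sub B(1) by (auto simp: fd_space_def)
qed

section \<open>Anti-pre-Lie algebras are Lie-admissible\<close>

text \<open>
  The cyclic sum of \<open>z \<cdot> [x,y]\<close> regroups into the cyclic sum of
  \<open>x \<cdot> (y \<cdot> z) - y \<cdot> (x \<cdot> z)\<close>, which the hypothesis converts into minus the cyclic sum of
  \<open>[x,y] \<cdot> z\<close>.
\<close>

lemma jacobiator_eq_twice_cyclic_sum:
  assumes A: "fd_space s A" and m: "bilinear_on s A s A m"
    and m_m: "\<And>x y z. x \<in> A \<Longrightarrow> y \<in> A \<Longrightarrow> z \<in> A \<Longrightarrow>
      m x (m y z) - m y (m x z) = m (commutator m y x) z"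
    and xyz: "x \<in> A" "y \<in> A" "z \<in> A"
  defines "cyc \<equiv> m (commutator m x y) z + m (commutator m y z) x + m (commutator m z x) y"
  shows "commutator m (commutator m x y) z + commutator m (commutator m y z) x
    + commutator m (commutator m z x) y = cyc + cyc"
proof -
  note cl = bilinear_on_closed[OF m]
  have "m x (m y z) - m y (m x z) = m (m y x) z - m (m x y) z"
    "m y (m z x) - m z (m y x) = m (m z y) x - m (m y z) x"
    "m z (m x y) - m x (m z y) = m (m x z) y - m (m z x) y"
    using m_m[of x y z] m_m[of y z x] m_m[of z x y] xyz
    by (simp_all add: commutator_def cl bilinear_on_diff[OF m A A])
  then have
    "m x (m y z) = m (m y x) z - m (m x y) z + m y (m x z)"
    "m y (m z x) = m (m z y) x - m (m y z) x + m z (m y x)"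
    "m z (m x y) = m (m x z) y - m (m z x) y + m x (m z y)"
    by (simp_all add: algebra_simps)
  then show ?thesis
    using xyz unfolding cyc_def
    by (simp add: commutator_def cl bilinear_on_diff[OF m A A])
qed

lemma lie_algebra_commutator:
  assumes "anti_pre_lie_algebra s A m"
  shows "lie_algebra s A (commutator m)"
proof -
  have A: "fd_space s A" and m: "bilinear_on s A s A m"
    using assms by (simp_all add: anti_pre_lie_algebra_def)
  have "commutator m (commutator m x y) z + commutator m (commutator m y z) x
      + commutator m (commutator m z x) y = 0" if "x \<in> A" "y \<in> A" "z \<in> A" for x y z
    using jacobiator_eq_twice_cyclic_sum[OF A m _ that] assms that
    by (simp add: anti_pre_lie_algebra_def)
  then show ?thesis
    using bilinear_on_commutator[OF m A] A
    by (simp add: lie_algebra_def) (simp add: commutator_def)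
qed

lemma compatible_lie_admissible_if_anti_pre_lie:
  assumes "compatible_anti_pre_lie_algebra s A m n"
  shows "compatible_lie_admissible_algebra s A m n"
proof -
  have "fd_space s A" "bilinear_on s A s A m" "bilinear_on s A s A n"
    using assms by (simp_all add: compatible_anti_pre_lie_algebra_def anti_pre_lie_algebra_def)
  moreover have "lie_algebra s A (lincomb s k1 (commutator m) k2 (commutator n))" for k1 k2
    using assms lie_algebra_commutator[of s A "lincomb s k1 m k2 n"]
    by (simp add: compatible_anti_pre_lie_algebra_def commutator_lincomb
        fd_space_module[OF \<open>fd_space s A\<close>])
  ultimately show ?thesis
    using assms
    by (simp add: compatible_lie_admissible_algebra_def compatible_lie_algebra_def
        compatible_anti_pre_lie_algebra_def lie_algebra_commutator)
qed

section \<open>The operation of an anti-\<open>\<O>\<close>-operator\<close>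

locale anti_O_product =
  fixes s :: "complex \<Rightarrow> 'g::ab_group_add \<Rightarrow> 'g" and G :: "'g set" and b :: "'g \<Rightarrow> 'g \<Rightarrow> 'g"
    and t :: "complex \<Rightarrow> 'v::ab_group_add \<Rightarrow> 'v" and V :: "'v set" and \<rho> :: "'g \<Rightarrow> 'v \<Rightarrow> 'v"
    and T :: "'v \<Rightarrow> 'g" and m :: "'v \<Rightarrow> 'v \<Rightarrow> 'v"
  assumes lie: "lie_algebra s G b"
    and rep: "lie_representation s G b t V \<rho>"
    and anti_O: "anti_O_operator s G b t V \<rho> T"
    and m_eq: "\<And>u v. u \<in> V \<Longrightarrow> v \<in> V \<Longrightarrow> m u v = - \<rho> (T u) v"
begin

lemma fd_G: "fd_space s G" using lie by (simp add: lie_algebra_def)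
lemma fd_V: "fd_space t V" using rep by (simp add: lie_representation_def)
lemma T_linear: "linear_on t V s G T" using anti_O by (simp add: anti_O_operator_def)
lemma \<rho>_bilinear: "bilinear_on s G t V \<rho>" using rep by (simp add: lie_representation_def)

lemmas V_closed = fd_space_closed[OF fd_V]
lemmas T_closed = linear_onD(1)[OF T_linear]
lemmas T_add = linear_onD(2)[OF T_linear]
lemmas T_scale = linear_onD(3)[OF T_linear]
lemmas T_diff = linear_on_diff[OF T_linear fd_V]

lemma m_bilinear: "bilinear_on t V t V m"
proof -
  have "linear_on t V t V (m u)" if "u \<in> V" for u
  proof -
    have "linear_on t V t V (\<rho> (T u))"
      using \<rho>_bilinear T_closed[OF that] by (simp add: bilinear_on_def)
    then show ?thesis
      using linear_on_uminus[OF _ fd_V] linear_on_cong[OF fd_V, of "m u" "\<lambda>v. - \<rho> (T u) v"]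
        m_eq that by blast
  qed
  moreover have "linear_on t V t V (\<lambda>u. m u v)" if "v \<in> V" for v
  proof -
    have "linear_on s G t V (\<lambda>x. \<rho> x v)"
      using \<rho>_bilinear that by (simp add: bilinear_on_def)
    then have "linear_on t V t V (\<lambda>u. - \<rho> (T u) v)"
      by (intro linear_on_uminus[OF _ fd_V] linear_on_compose[OF T_linear])
    then show ?thesis
      using linear_on_cong[OF fd_V, of "\<lambda>u. m u v" "\<lambda>u. - \<rho> (T u) v"] m_eq that by blast
  qed
  ultimately show ?thesis by (simp add: bilinear_on_def)
qed

lemmas m_closed = bilinear_on_closed[OF m_bilinear]

lemma commutator_m_closed: "u \<in> V \<Longrightarrow> v \<in> V \<Longrightarrow> commutator m u v \<in> V"
  by (simp add: commutator_def m_closed V_closed)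

lemma T_commutator: "u \<in> V \<Longrightarrow> v \<in> V \<Longrightarrow> T (commutator m u v) = b (T u) (T v)"
  using anti_O by (simp add: anti_O_operator_def commutator_def m_eq)

lemma commutator_m_left:
  "u \<in> V \<Longrightarrow> v \<in> V \<Longrightarrow> w \<in> V \<Longrightarrow> m (commutator m u v) w = - \<rho> (b (T u) (T v)) w"
  by (simp add: m_eq commutator_m_closed T_commutator)

lemma m_m_diff:
  assumes "u \<in> V" "v \<in> V" "w \<in> V"
  shows "m u (m v w) - m v (m u w) = m (commutator m v u) w"
proof -
  have neg: "\<rho> (T x) (- y) = - \<rho> (T x) y" if "x \<in> V" "y \<in> V" for x y
    using linear_on_minus[OF _ fd_V that(2), of t V "\<rho> (T x)"] \<rho>_bilinear T_closed that
    by (simp add: bilinear_on_def)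
  have "m x (m y w) = \<rho> (T x) (\<rho> (T y) w)" if "x \<in> V" "y \<in> V" for x y
    using neg[OF that(1) m_closed[OF that(2) assms(3)]] that assms m_closed
    by (simp add: m_eq)
  then show ?thesis
    using assms rep T_closed
    by (simp add: commutator_m_left lie_representation_def)
qed

text \<open>
  Evaluating \<open>m\<close> on commutators turns the strongness condition into the second
  anti-pre-Lie identity; the first one is \<open>m_m_diff\<close>.
\<close>

lemma anti_pre_lie_iff_strong:
  "anti_pre_lie_algebra t V m \<longleftrightarrow> strong_anti_O_operator s G b t V \<rho> T"
proof -
  have "m (commutator m u v) w + m (commutator m v w) u + m (commutator m w u) v = 0 \<longleftrightarrow>
      \<rho> (b (T u) (T v)) w + \<rho> (b (T v) (T w)) u + \<rho> (b (T w) (T u)) v = 0"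
    if "u \<in> V" "v \<in> V" "w \<in> V" for u v w
  proof -
    have "m (commutator m u v) w + m (commutator m v w) u + m (commutator m w u) v =
        - (\<rho> (b (T u) (T v)) w + \<rho> (b (T v) (T w)) u + \<rho> (b (T w) (T u)) v)"
      using that by (simp add: commutator_m_left)
    then show ?thesis by (simp only: neg_equal_0_iff_equal)
  qed
  then show ?thesis
    using fd_V m_bilinear m_m_diff anti_O
    by (simp add: anti_pre_lie_algebra_def strong_anti_O_operator_def)
qed

text \<open>
  The operation depends on \<open>u\<close> only through \<open>T u\<close>; exchanging the factors changes
  \<open>T (m u v)\<close> by \<open>b (T u) (T v)\<close>, so the same holds for \<open>v\<close> after applying \<open>T\<close>.
\<close>

lemma T_m_cong:
  assumes "u \<in> V" "u' \<in> V" "v \<in> V" "v' \<in> V" and eq: "T u = T u'" "T v = T v'"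
  shows "T (m u v) = T (m u' v')"
proof -
  have swap: "T (m x y) = b (T x) (T y) + T (m y x)" if "x \<in> V" "y \<in> V" for x y
    using T_commutator[OF that] that by (simp add: commutator_def T_diff m_closed algebra_simps)
  have "T (m u v) = T (m u' v)" using assms by (simp add: m_eq)
  also have "\<dots> = b (T u') (T v) + T (m v u')" using assms by (intro swap)
  also have "\<dots> = b (T u') (T v') + T (m v' u')" using assms by (simp add: m_eq)
  also have "\<dots> = T (m u' v')" using assms by (intro swap[symmetric])
  finally show ?thesis .
qed

text \<open>
  The second identity holds on the image for every \<open>T\<close>: its defect is half the
  Jacobiator of the commutator, and on \<open>T(V)\<close> this commutator is \<open>b\<close>.
\<close>

lemma anti_pre_lie_image:
  assumes m': "\<And>u v. u \<in> V \<Longrightarrow> v \<in> V \<Longrightarrow> m' (T u) (T v) = T (m u v)"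
  shows "anti_pre_lie_algebra s (T ` V) m'"
proof -
  let ?W = "T ` V"
  have W: "fd_space s ?W" by (rule fd_space_image[OF T_linear fd_V fd_G])
  have comm: "commutator m' (T u) (T v) = T (commutator m u v)" if "u \<in> V" "v \<in> V" for u v
    using that by (simp add: commutator_def m' m_closed T_diff)
  have bil: "bilinear_on s ?W s ?W m'"
  proof -
    have "m' (T u) (T v + T w) = m' (T u) (T v) + m' (T u) (T w)"
      "m' (T u + T v) (T w) = m' (T u) (T w) + m' (T v) (T w)"
      if "u \<in> V" "v \<in> V" "w \<in> V" for u v w
      using that
      by (simp_all add: m' T_add[symmetric] V_closed m_closed bilinear_on_add[OF m_bilinear])
    moreover have "m' (T u) (s c (T v)) = s c (m' (T u) (T v))"
      "m' (s c (T u)) (T v) = s c (m' (T u) (T v))" if "u \<in> V" "v \<in> V" for u v c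
      using that m_bilinear
      by (simp_all add: m' T_scale[symmetric] V_closed m_closed bilinear_on_def linear_on_def)
    moreover have "m' (T u) (T v) \<in> ?W" if "u \<in> V" "v \<in> V" for u v
      using that by (simp add: m' m_closed)
    ultimately show ?thesis by (simp add: bilinear_on_def linear_on_def)
  qed
  have m_m: "m' x (m' y z) - m' y (m' x z) = m' (commutator m' y x) z"
    if xyz: "x \<in> ?W" "y \<in> ?W" "z \<in> ?W" for x y z
  proof -
    obtain u v w where uvw: "u \<in> V" "v \<in> V" "w \<in> V" and eq: "x = T u" "y = T v" "z = T w"
      using xyz by blast
    have "T (m u (m v w)) - T (m v (m u w)) = T (m (commutator m v u) w)"
      using m_m_diff[OF uvw] uvw by (simp add: T_diff[symmetric] m_closed)
    then show ?thesis
      using uvw by (simp add: eq comm m' m_closed commutator_m_closed)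
  qed
  have "m' (commutator m' x y) z + m' (commutator m' y z) x + m' (commutator m' z x) y = 0"
    if xyz: "x \<in> ?W" "y \<in> ?W" "z \<in> ?W" for x y z
  proof -
    have comm_b: "commutator m' p q = b p q" if "p \<in> ?W" "q \<in> ?W" for p q
      using that by (auto simp: comm T_commutator)
    have closed: "b p q \<in> ?W" if "p \<in> ?W" "q \<in> ?W" for p q
      using that by (auto simp: T_commutator[symmetric] commutator_m_closed)
    have "x \<in> G" "y \<in> G" "z \<in> G" using xyz T_closed by auto
    then have "b (b x y) z + b (b y z) x + b (b z x) y = 0"
      using lie by (simp add: lie_algebra_def)
    then have "commutator m' (commutator m' x y) z + commutator m' (commutator m' y z) x
        + commutator m' (commutator m' z x) y = 0"
      using xyz by (simp add: comm_b closed)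
    from trans[OF jacobiator_eq_twice_cyclic_sum[OF W bil m_m xyz, symmetric] this]
    show ?thesis by (rule fd_space_double_eq_0[OF W])
  qed
  then show ?thesis using W bil m_m by (simp add: anti_pre_lie_algebra_def)
qed

end

section \<open>Compatible structures\<close>

theorem proposition3p3:
  fixes s :: "complex \<Rightarrow> 'g::ab_group_add \<Rightarrow> 'g" and G :: "'g set"
    and b1 b2 :: "'g \<Rightarrow> 'g \<Rightarrow> 'g"
    and t :: "complex \<Rightarrow> 'v::ab_group_add \<Rightarrow> 'v" and V :: "'v set"
    and \<rho> \<mu> :: "'g \<Rightarrow> 'v \<Rightarrow> 'v"
    and T :: "'v \<Rightarrow> 'g"
    and circ ast :: "'v \<Rightarrow> 'v \<Rightarrow> 'v"
  assumes "compatible_lie_algebra s G b1 b2"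
    and "compatible_representation s G b1 b2 t V \<rho> \<mu>"
    and "compatible_anti_O_operator s G b1 b2 t V \<rho> \<mu> T"
    and "\<And>u v. u \<in> V \<Longrightarrow> v \<in> V \<Longrightarrow> circ u v = - \<rho> (T u) v"
    and "\<And>u v. u \<in> V \<Longrightarrow> v \<in> V \<Longrightarrow> ast u v = - \<mu> (T u) v"
  shows "(\<forall>u\<in>V. \<forall>v\<in>V. \<forall>w\<in>V.
            circ u (ast v w) + ast u (circ v w) - circ v (ast u w) - ast v (circ u w)
              = circ (commutator ast v u) w + ast (commutator circ v u) w)
       \<and> (compatible_lie_admissible_algebra t V circ ast \<and>
            compatible_anti_pre_lie_algebra t V circ ast
          \<longleftrightarrow> strong_compatible_anti_O_operator s G b1 b2 t V \<rho> \<mu> T)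
       \<and> compatible_hom t V (commutator circ) (commutator ast) s G b1 b2 T
       \<and> (\<exists>circ' ast'.
            (\<forall>u\<in>V. \<forall>v\<in>V. circ' (T u) (T v) = T (circ u v)) \<and>
            (\<forall>u\<in>V. \<forall>v\<in>V. ast' (T u) (T v) = T (ast u v)) \<and>
            compatible_anti_pre_lie_algebra s (T ` V) circ' ast' \<and>
            compatible_hom t V circ ast s (T ` V) circ' ast' T)"
proof -
  let ?b = "\<lambda>k1 k2. lincomb s k1 b1 k2 b2"
  let ?\<rho> = "\<lambda>k1 k2. lincomb t k1 \<rho> k2 \<mu>"
  let ?m = "\<lambda>k1 k2. lincomb t k1 circ k2 ast"
  have fd_G: "fd_space s G"
    using assms(1) by (simp add: compatible_lie_algebra_def lie_algebra_def)
  have fd_V: "fd_space t V" using assms(2) by (simp add: compatible_representation_def)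
  interpret s: module s by (rule fd_space_module[OF fd_G])
  interpret t: module t by (rule fd_space_module[OF fd_V])
  have ms: "module s" and mt: "module t" by unfold_locales
  have pencil: "anti_O_product s G (?b k1 k2) t V (?\<rho> k1 k2) T (?m k1 k2)" for k1 k2
  proof
    show "lie_algebra s G (?b k1 k2)" using assms(1) by (simp add: compatible_lie_algebra_def)
    show "lie_representation s G (?b k1 k2) t V (?\<rho> k1 k2)"
      using assms(2) by (simp add: compatible_representation_def)
    show "anti_O_operator s G (?b k1 k2) t V (?\<rho> k1 k2) T"
      using assms(3) by (simp add: compatible_anti_O_operator_def)
    show "?m k1 k2 u v = - ?\<rho> k1 k2 (T u) v" if "u \<in> V" "v \<in> V" for u v
      using assms(4,5)[OF that] by (simp add: lincomb_def t.scale_minus_right)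
  qed
  interpret P1: anti_O_product s G b1 t V \<rho> T circ
    using pencil[of 1 0] by (simp add: ms mt)
  interpret P2: anti_O_product s G b2 t V \<mu> T ast
    using pencil[of 0 1] by (simp add: ms mt)
  interpret P12: anti_O_product s G "?b 1 1" t V "?\<rho> 1 1" T "\<lambda>u v. circ u v + ast u v"
    using pencil[of 1 1] by (simp add: lincomb_1_1[OF mt])
  have mixed: "circ u (ast v w) + ast u (circ v w) - circ v (ast u w) - ast v (circ u w)
      = circ (commutator ast v u) w + ast (commutator circ v u) w"
    if uvw: "u \<in> V" "v \<in> V" "w \<in> V" for u v w
  proof -
    note closed = P1.m_closed P2.m_closed P1.V_closed
    note bil = bilinear_on_add[OF P1.m_bilinear] bilinear_on_add[OF P2.m_bilinear]
      bilinear_on_diff[OF P1.m_bilinear fd_V fd_V] bilinear_on_diff[OF P2.m_bilinear fd_V fd_V]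
    \<comment> \<open>The mixed terms are what remains of the identity for \<open>circ + ast\<close> after
      removing those for \<open>circ\<close> and \<open>ast\<close>.\<close>
    have 1: "circ u (circ v w) = circ v (circ u w) + circ (commutator circ v u) w"
      using P1.m_m_diff[OF uvw] by (simp add: algebra_simps)
    have 2: "ast u (ast v w) = ast v (ast u w) + ast (commutator ast v u) w"
      using P2.m_m_diff[OF uvw] by (simp add: algebra_simps)
    show ?thesis
      using P12.m_m_diff[OF uvw] uvw 1 2
      by (simp add: commutator_def closed bil algebra_simps)
  qed
  have "compatible_anti_pre_lie_algebra t V circ ast \<longleftrightarrow>
      (\<forall>k1 k2. anti_pre_lie_algebra t V (?m k1 k2))"
    unfolding compatible_anti_pre_lie_algebra_def
    using lincomb_1_0[OF mt, of circ ast] lincomb_0_1[OF mt, of circ ast] by metis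
  also have "\<dots> \<longleftrightarrow> strong_compatible_anti_O_operator s G b1 b2 t V \<rho> \<mu> T"
    unfolding strong_compatible_anti_O_operator_def
    using anti_O_product.anti_pre_lie_iff_strong[OF pencil] by simp
  finally have strong: "compatible_lie_admissible_algebra t V circ ast \<and>
      compatible_anti_pre_lie_algebra t V circ ast
      \<longleftrightarrow> strong_compatible_anti_O_operator s G b1 b2 t V \<rho> \<mu> T"
    using compatible_lie_admissible_if_anti_pre_lie by blast
  have hom: "compatible_hom t V (commutator circ) (commutator ast) s G b1 b2 T"
    using P1.T_linear P1.T_commutator P2.T_commutator by (simp add: compatible_hom_def)
  define pre where "pre = inv_into V T"
  have pre: "pre (T u) \<in> V" "T (pre (T u)) = T u" if "u \<in> V" for u
    unfolding pre_def using that by (simp_all add: inv_into_into f_inv_into_f)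
  define circ' where "circ' = (\<lambda>x y. T (circ (pre x) (pre y)))"
  define ast' where "ast' = (\<lambda>x y. T (ast (pre x) (pre y)))"
  have circ': "circ' (T u) (T v) = T (circ u v)" if "u \<in> V" "v \<in> V" for u v
    unfolding circ'_def using that by (intro P1.T_m_cong) (simp_all add: pre)
  have ast': "ast' (T u) (T v) = T (ast u v)" if "u \<in> V" "v \<in> V" for u v
    unfolding ast'_def using that by (intro P2.T_m_cong) (simp_all add: pre)
  have "anti_pre_lie_algebra s (T ` V) (lincomb s k1 circ' k2 ast')" for k1 k2
  proof (rule anti_O_product.anti_pre_lie_image[OF pencil])
    show "lincomb s k1 circ' k2 ast' (T u) (T v) = T (?m k1 k2 u v)"
      if "u \<in> V" "v \<in> V" for u v
      using that
      by (simp add: lincomb_def circ' ast' P1.T_add P1.T_scale P1.V_closed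
          P1.m_closed P2.m_closed)
  qed
  then have image: "compatible_anti_pre_lie_algebra s (T ` V) circ' ast'"
    using P1.anti_pre_lie_image[OF circ'] P2.anti_pre_lie_image[OF ast']
    by (simp add: compatible_anti_pre_lie_algebra_def)
  have "linear_on t V s (T ` V) T" using P1.T_linear by (simp add: linear_on_def)
  then have "compatible_hom t V circ ast s (T ` V) circ' ast' T"
    by (simp add: compatible_hom_def circ' ast')
  then show ?thesis using mixed strong hom circ' ast' image by blast
qed

end
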